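(* Let $m\ge 2$, $n\ge 1$ and $\bar{\mathcal A}\in\mathcal T_{m,n}$. Suppose that $\bar{\mathcal A}$ is copositive and that for every nonempty subset $\alpha\subseteq I_n$ the set ${\rm Tpos}(\mathbb R^n_+,\mathcal C_{\bar{\mathcal A}}(\alpha))$ is closed. Then ${\rm SOL}(\mathbb R^n_+,\mathbf q,\bar{\mathcal A})\neq\emptyset$ for every $\mathbf q\in S_{\bar{\mathcal A}}^*$. Moreover, ${\rm SOL}(\mathbb R^n_+,\mathbf q,\bar{\mathcal A})$ is compact for every $\mathbf q\in{\rm int}(S_{\bar{\mathcal A}}^* )$.
   Context: $\mathcal T_{m,n}$ is the space of real $m$-th order $n$-dimensional tensors $\mathcal A=(a_{i_1\ldots i_m})_{1\le i_1,\ldots,i_m\le n}$; $I_n=\{1,\ldots,n\}$. For $\mathbf x\in\mathbb R^n$, $\mathcal A\mathbf x^{m-1}\in\mathbb R^n$ has components $(\mathcal A\mathbf x^{m-1})_i=\sum_{i_2,\ldots,i_m=1}^n a_{ii_2\ldots i_m}x_{i_2}\cdots x_{i_m}$, and $\mathcal A\mathbf x^m=\mathbf x^\top\mathcal A\mathbf x^{m-1}$. $\mathcal A$ is copositive if $\mathcal A\mathbf x^m\ge 0$ for all $\mathbf x\in\mathbb R^n_+=\{\mathbf x:\ x_i\ge0\ \forall i\}$. For a closed convex cone $K\subseteq\mathbb R^n$, $K^*=\{\mathbf y:\langle\mathbf y,\mathbf x\rangle\ge0\ \forall \mathbf x\in K\}$ is the dual cone, and $${\rm SOL}(K,\mathbf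 q,\mathcal A)=\{\mathbf x\in K:\ \mathcal A\mathbf x^{m-1}+\mathbf q\in K^*,\ \langle\mathbf x,\mathcal A\mathbf x^{m-1}+\mathbf q\rangle=0\}.$$ $S_{\mathcal A}:={\rm SOL}(\mathbb R^n_+,\mathbf 0,\mathcal A)$ is a cone (not necessarily convex), and $S_{\mathcal A}^*=\{\mathbf y:\langle\mathbf y,\mathbf x\rangle\ge0\ \forall\mathbf x\in S_{\mathcal A}\}$; ${\rm int}$ denotes topological interior. ${\rm Tpos}(K,\mathcal A):=\{\mathcal A\mathbf x^{m-1}:\mathbf x\in K\}$. For $\alpha\subseteq I_n$, the complementary tensor $\mathcal C_{\mathcal A}(\alpha)\in\mathcal T_{m,n}$ has entries $(\mathcal C_{\mathcal A}(\alpha))_{i_1\ldots i_m}=-a_{i_1\ldots i_m}$ if $i_1\in I_n$ and $i_2,\ldots,i_m\in\alpha$; $=\sigma_{i_1\ldots i_m}$ if $i_1,\ldots,i_m\notin\alpha$; and $=0$ otherwise, where $\sigma_{i_1\ldots i_m}=1$ if $i_1=\cdots=i_m$ and $0$ otherwise. *)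

theory Defs
  imports "HOL-Analysis.Analysis"
begin

(* Indices range over a finite type 'n, so I_n = UNIV and n = CARD('n) >= 1.
   An m-th order tensor is given by its entries, A [i_1, ..., i_m] = a_{i_1 ... i_m}.
   The order m is passed separately: values of A at lists of length other than m are
   never used, so every function of this type denotes an element of T_{m,n} and every
   element of T_{m,n} is denoted by one. *)
type_synonym 'n tensor = "'n list \<Rightarrow> real"

definition tensor_apply :: "nat \<Rightarrow> 'n::finite tensor \<Rightarrow> real ^ 'n \<Rightarrow> real ^ 'n" where
  "tensor_apply m A x =
     (\<chi> i. \<Sum>js\<in>{js. length js = m - 1}. A (i # js) * (\<Prod>j\<leftarrow>js. x $ j))"

definition tensor_form :: "nat \<Rightarrow> 'n::finite tensor \<Rightarrow> real ^ 'n \<Rightarrow> real" where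
  "tensor_form m A x = x \<bullet> tensor_apply m A x"

definition nonneg_orthant :: "(real ^ 'n::finite) set" where
  "nonneg_orthant = {x. \<forall>i. 0 \<le> x $ i}"

definition copositive :: "nat \<Rightarrow> 'n::finite tensor \<Rightarrow> bool" where
  "copositive m A \<longleftrightarrow> (\<forall>x\<in>nonneg_orthant. 0 \<le> tensor_form m A x)"

definition dual_cone :: "(real ^ 'n::finite) set \<Rightarrow> (real ^ 'n) set" where
  "dual_cone K = {y. \<forall>x\<in>K. 0 \<le> y \<bullet> x}"

definition SOL :: "nat \<Rightarrow> (real ^ 'n::finite) set \<Rightarrow> real ^ 'n \<Rightarrow> 'n tensor \<Rightarrow> (real ^ 'n) set" where
  "SOL m K q A =
     {x \<in> K. tensor_apply m A x + q \<in> dual_cone K \<and> x \<bullet> (tensor_apply m A x + q) = 0}"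

definition Tpos :: "nat \<Rightarrow> (real ^ 'n::finite) set \<Rightarrow> 'n tensor \<Rightarrow> (real ^ 'n) set" where
  "Tpos m K A = tensor_apply m A ` K"

definition unit_tensor :: "'n tensor" where
  "unit_tensor is = (if \<forall>i\<in>set is. \<forall>j\<in>set is. i = j then 1 else 0)"

(* For lists of length m >= 2 the first two cases exclude each other. *)
definition complementary_tensor :: "'n tensor \<Rightarrow> 'n set \<Rightarrow> 'n tensor" where
  "complementary_tensor A \<alpha> is =
     (if \<forall>i\<in>set (tl is). i \<in> \<alpha> then - A is
      else if \<forall>i\<in>set is. i \<notin> \<alpha> then unit_tensor is
      else 0)"

end

theory Submission
  imports Defs
begin

text \<open>
  Write \<open>F x\<close> for \<open>A x^(m-1)\<close> and \<open>S\<close> for the solution cone of the homogeneous problem.  Two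
  independent facts combine.

  \<^item> Interior vectors are solvable (lemma \<open>SOL_interior\<close>).  On the truncated orthant
    \<open>{x \<ge> 0. sum x \<le> r}\<close>, which is compact and convex, Brouwer's theorem gives a solution of the
    variational inequality for \<open>F + q\<close> (lemma \<open>variational_inequality_solvable\<close>).  If such
    solutions were unbounded as \<open>r\<close> grows, rescaling them to \<open>sum x = 1\<close> and passing to the limit
    would make the constant term \<open>q\<close> negligible, because \<open>F\<close> is homogeneous of degree \<open>m - 1 > 0\<close>;
    the limit \<open>u\<close> would be a nonzero element of \<open>S\<close>.  Testing the inequality against \<open>0\<close> gives
    \<open>(F x + q) \<bullet> x \<le> 0\<close>, so copositivity yields \<open>q \<bullet> u \<le> 0\<close>, whereas
    \<open>q \<bullet> u > 0\<close> if \<open>q\<close> lies in the interior of the dual cone of \<open>S\<close>.  So the truncated solutions are bounded (lemma \<open>bounded_truncated_solutions\<close>), and for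
    large \<open>r\<close> the truncation is not active.  Genuine solutions also solve truncated problems, hence
    the same bound yields compactness.

  \<^item> The set of solvable \<open>q\<close> is closed (lemmas \<open>solvable_iff_Tpos\<close> and \<open>closed_solvable\<close>).  A solution with support
    \<open>\<alpha>\<close> and slack \<open>w = F x + q\<close> writes \<open>q = w - F x\<close>, with \<open>x\<close> living on \<open>\<alpha>\<close> and \<open>w\<close> off \<open>\<alpha>\<close>.
    The complementary tensor is made so that its values on the orthant are exactly such
    differences.  Hence the solvable vectors form the union, over the finitely many \<open>\<alpha>\<close>, of the
    closed sets in the hypothesis, together with the orthant itself for \<open>\<alpha> = {}\<close>.

  The dual cone of \<open>S\<close> is convex and contains the orthant, so it lies in the closure of its
  interior; the closed set of solvable vectors then contains all of it.
\<close>

section \<open>The polynomial map of a tensor\<close>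

lemma finite_lists_of_length: "finite {js :: 'n::finite list. length js = k}"
  using finite_lists_length_eq[of "UNIV :: 'n set" k] by simp

lemma continuous_on_tensor_apply:
  fixes A :: "'n::finite tensor"
  shows "continuous_on X (tensor_apply m A)"
proof -
  have "continuous_on X (\<lambda>x::real^'n. \<Prod>j\<leftarrow>js. x $ j)" for js :: "'n list"
    by (induction js) (auto intro!: continuous_intros)
  then show ?thesis
    unfolding tensor_apply_def by (intro continuous_intros)
qed

lemma tensor_apply_scaleR:
  fixes A :: "'n::finite tensor"
  shows "tensor_apply m A (c *\<^sub>R x) = c ^ (m - 1) *\<^sub>R tensor_apply m A x"
proof -
  have "(\<Prod>j\<leftarrow>js. (c *\<^sub>R x) $ j) = c ^ length js * (\<Prod>j\<leftarrow>js. x $ j)" for js :: "'n list"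
    by (induction js) auto
  then show ?thesis
    by (simp add: tensor_apply_def vec_eq_iff sum_distrib_left mult.left_commute)
qed

lemma tensor_apply_zero: "m \<ge> 2 \<Longrightarrow> tensor_apply m A 0 = 0"
  using tensor_apply_scaleR[of m A 0 0] by (simp add: zero_power)

section \<open>Cones and solution sets\<close>

lemma dual_cone_nonneg_orthant:
  "dual_cone nonneg_orthant = (nonneg_orthant :: (real^'n::finite) set)"
proof (intro equalityI subsetI)
  fix y :: "real^'n" assume y: "y \<in> dual_cone nonneg_orthant"
  have "0 \<le> y $ i" for i
  proof -
    have "axis i 1 \<in> nonneg_orthant" by (simp add: nonneg_orthant_def axis_def)
    with y show ?thesis by (fastforce simp: dual_cone_def inner_axis)
  qed
  then show "y \<in> nonneg_orthant" by (simp add: nonneg_orthant_def)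
next
  fix y :: "real^'n" assume "y \<in> nonneg_orthant"
  then show "y \<in> dual_cone nonneg_orthant"
    by (auto simp: dual_cone_def nonneg_orthant_def inner_vec_def intro!: sum_nonneg)
qed

lemma closed_nonneg_orthant: "closed (nonneg_orthant :: (real^'n::finite) set)"
  unfolding nonneg_orthant_def by (intro closed_Collect_all closed_Collect_le continuous_intros)

lemma SOL_nonneg_orthant_iff:
  "x \<in> SOL m nonneg_orthant q A \<longleftrightarrow>
     x \<in> nonneg_orthant \<and> tensor_apply m A x + q \<in> nonneg_orthant \<and>
     x \<bullet> (tensor_apply m A x + q) = 0"
  by (simp add: SOL_def dual_cone_nonneg_orthant)

lemma closed_SOL: "closed (SOL m nonneg_orthant q A)"
proof -
  have 1: "continuous_on UNIV (\<lambda>x. tensor_apply m A x + q)"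
    by (intro continuous_intros continuous_on_tensor_apply)
  have "SOL m nonneg_orthant q A =
          nonneg_orthant \<inter> (\<lambda>x. tensor_apply m A x + q) -` nonneg_orthant \<inter>
          {x. x \<bullet> (tensor_apply m A x + q) = 0}"
    by (auto simp: SOL_nonneg_orthant_iff)
  moreover have "closed ((\<lambda>x. tensor_apply m A x + q) -` nonneg_orthant)"
    using 1 closed_nonneg_orthant continuous_on_closed_vimage[of UNIV] by fastforce
  moreover have "closed {x. x \<bullet> (tensor_apply m A x + q) = 0}"
    by (intro closed_Collect_eq continuous_intros continuous_on_tensor_apply)
  ultimately show ?thesis
    by (simp add: closed_Int closed_nonneg_orthant)
qed

lemma convex_dual_cone: "convex (dual_cone K)"
  by (rule convexI) (auto simp: dual_cone_def inner_add_left)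

text \<open>A subset \<open>K\<close> of the orthant has a dual cone with interior, as the dual cone contains a
  neighbourhood of the all-ones vector.\<close>

lemma dual_cone_subset_closure_interior:
  fixes K :: "(real^'n::finite) set"
  assumes "K \<subseteq> nonneg_orthant"
  shows "dual_cone K \<subseteq> closure (interior (dual_cone K))"
proof -
  have "nonneg_orthant \<subseteq> dual_cone K"
    using assms dual_cone_nonneg_orthant unfolding dual_cone_def by blast
  moreover have "ball (vec 1) 1 \<subseteq> (nonneg_orthant :: (real^'n) set)"
  proof
    fix y :: "real^'n" assume "y \<in> ball (vec 1) 1"
    moreover have "\<bar>(vec 1 - y) $ i\<bar> \<le> norm (vec 1 - y)" for i
      by (rule component_le_norm_cart)
    ultimately have "\<bar>1 - y $ i\<bar> < 1" for i
      by (simp add: dist_norm) (meson le_less_trans)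
    then have "0 \<le> y $ i" for i
      using abs_less_iff[of "1 - y $ i" 1] by (smt (verit))
    then show "y \<in> nonneg_orthant" by (simp add: nonneg_orthant_def)
  qed
  ultimately have "vec 1 \<in> interior (dual_cone K)"
    by (meson centre_in_ball interiorI open_ball order_trans zero_less_one)
  then have "closure (interior (dual_cone K)) = closure (dual_cone K)"
    by (intro convex_closure_interior convex_dual_cone) auto
  then show ?thesis by (simp add: closure_subset)
qed

text \<open>An interior point \<open>q\<close> can be moved a little in the direction \<open>- u\<close> without leaving the dual
  cone, and the moved point still has a nonnegative product with \<open>u\<close>.\<close>

lemma interior_dual_cone_pos:
  assumes q: "q \<in> interior (dual_cone K)" and u: "u \<in> K" "u \<noteq> 0"
  shows "0 < q \<bullet> u"
proof -
  obtain e where e: "e > 0" "cball q e \<subseteq> dual_cone K"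
    using q mem_interior_cball by blast
  have "q - (e / norm u) *\<^sub>R u \<in> cball q e"
    using e u by (simp add: dist_norm)
  with e have "q - (e / norm u) *\<^sub>R u \<in> dual_cone K" by blast
  with u have "0 \<le> (q - (e / norm u) *\<^sub>R u) \<bullet> u"
    by (simp add: dual_cone_def)
  then have "e * norm u \<le> q \<bullet> u"
    using u by (simp add: inner_diff_left power2_norm_eq_inner[symmetric] power2_eq_square)
  then show ?thesis
    using e u by (smt (verit) mult_pos_pos zero_less_norm_iff)
qed

section \<open>Solvable vectors and complementary tensors\<close>

text \<open>The two nonzero kinds of entries act separately: the entries \<open>- a\<close> see only the part of \<open>y\<close>
  on \<open>\<alpha>\<close>, while the unit entries contribute the powers of the coordinates off \<open>\<alpha>\<close>.\<close>

lemma tensor_apply_complementary: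
  fixes A :: "'n::finite tensor"
  assumes m: "m \<ge> 2"
  shows "tensor_apply m (complementary_tensor A \<alpha>) y =
    (\<chi> i. if i \<in> \<alpha> then 0 else y $ i ^ (m - 1)) -
    tensor_apply m A (\<chi> i. if i \<in> \<alpha> then y $ i else 0)"
proof -
  let ?L = "{js :: 'n list. length js = m - 1}"
  define x where "x = (\<chi> i. if i \<in> \<alpha> then y $ i else 0)"
  have prod_x: "(\<Prod>j\<leftarrow>js. x $ j) = (if set js \<subseteq> \<alpha> then \<Prod>j\<leftarrow>js. y $ j else 0)" for js
    by (induction js) (auto simp: x_def)
  have entry: "complementary_tensor A \<alpha> (i # js) * (\<Prod>j\<leftarrow>js. y $ j) =
      (if js = replicate (m - 1) i then if i \<in> \<alpha> then 0 else y $ i ^ (m - 1) else 0) -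
      A (i # js) * (\<Prod>j\<leftarrow>js. x $ j)" if js: "js \<in> ?L" for i js
  proof -
    have ne: "js \<noteq> []" using js m by auto
    have rep: "js = replicate (m - 1) i \<longleftrightarrow> (\<forall>j\<in>set js. j = i)"
      using js replicate_eqI[of js "m - 1" i] by (metis (mono_tags) in_set_replicate mem_Collect_eq)
    have unit: "unit_tensor (i # js) = (if js = replicate (m - 1) i then 1 else 0)"
      unfolding rep by (auto simp: unit_tensor_def)
    have pow: "(\<Prod>j\<leftarrow>replicate (m - 1) i. y $ j) = y $ i ^ (m - 1)"
      by simp
    obtain j where j: "j \<in> set js" using ne by (cases js) auto
    show ?thesis
    proof (cases "set js \<subseteq> \<alpha>")
      case True
      then have "i \<in> \<alpha>" if "js = replicate (m - 1) i"
        using that rep j by auto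
      with True show ?thesis
        by (auto simp: complementary_tensor_def prod_x subset_iff)
    next
      case False
      then have "complementary_tensor A \<alpha> (i # js) =
          (if js = replicate (m - 1) i \<and> i \<notin> \<alpha> then 1 else 0)"
        using unit rep by (auto simp: complementary_tensor_def)
      then show ?thesis
        using False pow by (auto simp: prod_x)
    qed
  qed
  have "(\<Sum>js\<in>?L. complementary_tensor A \<alpha> (i # js) * (\<Prod>j\<leftarrow>js. y $ j)) =
      (if i \<in> \<alpha> then 0 else y $ i ^ (m - 1)) - (\<Sum>js\<in>?L. A (i # js) * (\<Prod>j\<leftarrow>js. x $ j))" for i
    by (simp add: entry sum_subtractf finite_lists_of_length)
  then show ?thesis
    unfolding x_def[symmetric] by (simp add: tensor_apply_def vec_eq_iff)
qed

text \<open>Taking \<open>(m-1)\<close>-st roots realizes every nonnegative slack off \<open>\<alpha>\<close> by the unit entries.\<close>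

lemma Tpos_complementary_iff:
  fixes A :: "'n::finite tensor"
  assumes m: "m \<ge> 2"
  shows "q \<in> Tpos m nonneg_orthant (complementary_tensor A \<alpha>) \<longleftrightarrow>
    (\<exists>x\<in>nonneg_orthant. \<exists>w\<in>nonneg_orthant.
       (\<forall>i. i \<notin> \<alpha> \<longrightarrow> x $ i = 0) \<and> (\<forall>i\<in>\<alpha>. w $ i = 0) \<and> q = w - tensor_apply m A x)"
    (is "?L \<longleftrightarrow> ?R")
proof
  assume ?L
  then obtain y where y: "y \<in> nonneg_orthant"
      and q: "q = tensor_apply m (complementary_tensor A \<alpha>) y"
    by (auto simp: Tpos_def)
  show ?R
    using y unfolding q tensor_apply_complementary[OF m]
    by (intro bexI[where x = "\<chi> i. if i \<in> \<alpha> then y $ i else 0"]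
          bexI[where x = "\<chi> i. if i \<in> \<alpha> then 0 else y $ i ^ (m - 1)"])
       (auto simp: nonneg_orthant_def)
next
  assume ?R
  then obtain x w where x: "\<forall>i. 0 \<le> x $ i" "\<forall>i. i \<notin> \<alpha> \<longrightarrow> x $ i = 0"
    and w: "\<forall>i. 0 \<le> w $ i" "\<forall>i\<in>\<alpha>. w $ i = 0" and q: "q = w - tensor_apply m A x"
    unfolding nonneg_orthant_def by blast
  define y where "y = (\<chi> i. if i \<in> \<alpha> then x $ i else root (m - 1) (w $ i))"
  have "y \<in> nonneg_orthant"
    using x w m by (auto simp: nonneg_orthant_def y_def)
  moreover have "(\<chi> i. if i \<in> \<alpha> then 0 else y $ i ^ (m - 1)) = w"
    using w m by (auto simp: vec_eq_iff y_def)
  moreover have "(\<chi> i. if i \<in> \<alpha> then y $ i else 0) = x"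
    using x by (auto simp: vec_eq_iff y_def)
  ultimately have "q = tensor_apply m (complementary_tensor A \<alpha>) y" "y \<in> nonneg_orthant"
    using q by (simp_all add: tensor_apply_complementary[OF m])
  then show ?L
    unfolding Tpos_def by (rule image_eqI)
qed

text \<open>Complementarity of \<open>x \<ge> 0\<close> and \<open>w = F x + q \<ge> 0\<close> says that the support \<open>\<alpha>\<close> of \<open>x\<close> misses
  that of \<open>w\<close>.\<close>

lemma solvable_iff_Tpos:
  fixes A :: "'n::finite tensor"
  assumes m: "m \<ge> 2"
  shows "SOL m nonneg_orthant q A \<noteq> {} \<longleftrightarrow>
    (\<exists>\<alpha>. q \<in> Tpos m nonneg_orthant (complementary_tensor A \<alpha>))"
proof
  assume "SOL m nonneg_orthant q A \<noteq> {}"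
  then obtain x where sol: "x \<in> SOL m nonneg_orthant q A" by blast
  let ?w = "tensor_apply m A x + q"
  from sol have x: "x \<in> nonneg_orthant" and w: "?w \<in> nonneg_orthant" and c: "x \<bullet> ?w = 0"
    by (auto simp: SOL_nonneg_orthant_iff)
  have "(\<Sum>i\<in>UNIV. x $ i * ?w $ i) = 0"
    using c by (simp add: inner_vec_def)
  then have prod: "x $ i * ?w $ i = 0" for i
    using x w by (subst (asm) sum_nonneg_eq_0_iff) (auto simp: nonneg_orthant_def)
  have "\<forall>i\<in>{i. x $ i \<noteq> 0}. ?w $ i = 0"
    using prod mult_eq_0_iff by blast
  then have "q \<in> Tpos m nonneg_orthant (complementary_tensor A {i. x $ i \<noteq> 0})"
    unfolding Tpos_complementary_iff[OF m]
    by (intro bexI[OF _ x] bexI[OF _ w]) simp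
  then show "\<exists>\<alpha>. q \<in> Tpos m nonneg_orthant (complementary_tensor A \<alpha>)" ..
next
  assume "\<exists>\<alpha>. q \<in> Tpos m nonneg_orthant (complementary_tensor A \<alpha>)"
  then obtain \<alpha> x w where x: "x \<in> nonneg_orthant" "\<forall>i. i \<notin> \<alpha> \<longrightarrow> x $ i = 0"
    and w: "w \<in> nonneg_orthant" "\<forall>i\<in>\<alpha>. w $ i = 0" and q: "q = w - tensor_apply m A x"
    unfolding Tpos_complementary_iff[OF m] by blast
  have "x $ i * w $ i = 0" for i
    using x w by (cases "i \<in> \<alpha>") auto
  then have "x \<bullet> w = 0"
    unfolding inner_vec_def by (intro sum.neutral) simp
  then have "x \<in> SOL m nonneg_orthant q A"
    using x w q by (simp add: SOL_nonneg_orthant_iff)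
  then show "SOL m nonneg_orthant q A \<noteq> {}" by blast
qed

text \<open>For \<open>\<alpha> = {}\<close> the only admissible \<open>x\<close> is \<open>0\<close>, so this piece is the orthant.\<close>

lemma closed_solvable:
  fixes A :: "'n::finite tensor"
  assumes m: "m \<ge> 2"
    and cl: "\<And>\<alpha> :: 'n set. \<alpha> \<noteq> {} \<Longrightarrow>
      closed (Tpos m nonneg_orthant (complementary_tensor A \<alpha>))"
  shows "closed {q. SOL m nonneg_orthant q A \<noteq> {}}"
proof -
  have "q \<in> Tpos m nonneg_orthant (complementary_tensor A {}) \<longleftrightarrow> q \<in> nonneg_orthant" for q
  proof -
    have "(\<forall>i. x $ i = 0) \<longleftrightarrow> x = 0" for x :: "real^'n" by (simp add: vec_eq_iff)
    moreover have "(0 :: real^'n) \<in> nonneg_orthant" by (simp add: nonneg_orthant_def)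
    ultimately show ?thesis
      unfolding Tpos_complementary_iff[OF m] by (auto simp: tensor_apply_zero[OF m])
  qed
  then have "Tpos m nonneg_orthant (complementary_tensor A {}) = nonneg_orthant" by blast
  with cl have "closed (Tpos m nonneg_orthant (complementary_tensor A \<alpha>))" for \<alpha>
    using closed_nonneg_orthant by (cases "\<alpha> = {}") auto
  then have "closed (\<Union>\<alpha>. Tpos m nonneg_orthant (complementary_tensor A \<alpha>))"
    by (intro closed_UN) auto
  moreover have "{q. SOL m nonneg_orthant q A \<noteq> {}} =
      (\<Union>\<alpha>. Tpos m nonneg_orthant (complementary_tensor A \<alpha>))"
    using solvable_iff_Tpos[OF m] by auto
  ultimately show ?thesis by simp
qed

section \<open>Truncated variational inequalities\<close>

text \<open>A fixed point \<open>x\<close> of the map that sends \<open>x\<close> to the projection of \<open>x - G x\<close> onto \<open>D\<close> solves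
  the inequality: this is the obtuse angle property of the projection.\<close>

lemma variational_inequality_solvable:
  fixes G :: "'a::euclidean_space \<Rightarrow> 'a"
  assumes D: "compact D" "convex D" "D \<noteq> {}" and G: "continuous_on D G"
  obtains x where "x \<in> D" "\<And>y. y \<in> D \<Longrightarrow> 0 \<le> G x \<bullet> (y - x)"
proof -
  have cl: "closed D" using D compact_imp_closed by blast
  have "continuous_on UNIV (closest_point D)"
    using D cl by (intro continuous_on_closest_point)
  then have "continuous_on D (\<lambda>x. closest_point D (x - G x))"
    by (rule continuous_on_compose2) (use G in \<open>auto intro!: continuous_intros\<close>)
  moreover have "(\<lambda>x. closest_point D (x - G x)) \<in> D \<rightarrow> D"
    using cl D by (auto intro: closest_point_in_set)
  ultimately obtain x where x: "x \<in> D" "closest_point D (x - G x) = x"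
    using brouwer[OF D] by blast
  have "0 \<le> G x \<bullet> (y - x)" if "y \<in> D" for y
    using closest_point_dot[OF D(2) cl that, of "x - G x"] x by simp
  with x that show ?thesis by blast
qed

text \<open>Solutions of truncated problems, each relative to its own truncation level \<open>sum x\<close>.  The set
  contains both the solutions of the complementarity problem and those that Brouwer's theorem
  provides on the truncated orthants, so that one bound serves for compactness and for
  existence.\<close>

definition truncated_solutions :: "nat \<Rightarrow> real ^ 'n::finite \<Rightarrow> 'n tensor \<Rightarrow> (real ^ 'n) set" where
  "truncated_solutions m q A =
     {x \<in> nonneg_orthant. \<forall>y\<in>nonneg_orthant. (\<Sum>i\<in>UNIV. y $ i) \<le> (\<Sum>i\<in>UNIV. x $ i) \<longrightarrow>
        0 \<le> (tensor_apply m A x + q) \<bullet> (y - x)}"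

lemma SOL_subset_truncated_solutions:
  "SOL m nonneg_orthant q A \<subseteq> truncated_solutions m q A"
proof
  fix x assume x: "x \<in> SOL m nonneg_orthant q A"
  then have "tensor_apply m A x + q \<in> dual_cone nonneg_orthant"
    by (simp add: SOL_def)
  with x show "x \<in> truncated_solutions m q A"
    by (auto simp: truncated_solutions_def SOL_def dual_cone_def inner_diff_right
        inner_commute[of _ x])
qed

lemma norm_le_sum_nonneg_orthant:
  "x \<in> nonneg_orthant \<Longrightarrow> norm x \<le> (\<Sum>i\<in>UNIV. x $ i)"
  using norm_le_l1_cart[of x] by (simp add: nonneg_orthant_def)

lemma compact_truncated_orthant:
  "compact {x \<in> nonneg_orthant :: (real^'n::finite) set. (\<Sum>i\<in>UNIV. x $ i) \<le> r}"
proof -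
  have "closed {x :: real^'n. (\<Sum>i\<in>UNIV. x $ i) \<le> r}"
    by (intro closed_Collect_le continuous_intros)
  then have "closed (nonneg_orthant \<inter> {x :: real^'n. (\<Sum>i\<in>UNIV. x $ i) \<le> r})"
    by (intro closed_Int closed_nonneg_orthant)
  moreover have "bounded {x \<in> nonneg_orthant :: (real^'n) set. (\<Sum>i\<in>UNIV. x $ i) \<le> r}"
    using norm_le_sum_nonneg_orthant by (intro boundedI[where B = r]) fastforce
  ultimately show ?thesis
    by (simp add: compact_eq_bounded_closed Int_def)
qed

lemma compact_simplex:
  "compact {x \<in> nonneg_orthant :: (real^'n::finite) set. (\<Sum>i\<in>UNIV. x $ i) = r}"
proof -
  have "closed {x :: real^'n. (\<Sum>i\<in>UNIV. x $ i) = r}"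
    by (intro closed_Collect_eq continuous_intros)
  then have "compact ({x \<in> nonneg_orthant :: (real^'n) set. (\<Sum>i\<in>UNIV. x $ i) \<le> r} \<inter>
      {x. (\<Sum>i\<in>UNIV. x $ i) = r})"
    by (rule compact_Int_closed[OF compact_truncated_orthant])
  then show ?thesis
    by (rule back_subst[of compact]) auto
qed

lemma convex_truncated_orthant:
  "convex {x \<in> nonneg_orthant :: (real^'n::finite) set. (\<Sum>i\<in>UNIV. x $ i) \<le> r}"
proof (rule convexI)
  fix x y :: "real^'n" and u v :: real
  assume x: "x \<in> {x \<in> nonneg_orthant. (\<Sum>i\<in>UNIV. x $ i) \<le> r}"
    and y: "y \<in> {x \<in> nonneg_orthant. (\<Sum>i\<in>UNIV. x $ i) \<le> r}"
    and uv: "0 \<le> u" "0 \<le> v" "u + v = 1"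
  have "(\<Sum>i\<in>UNIV. (u *\<^sub>R x + v *\<^sub>R y) $ i) = u * (\<Sum>i\<in>UNIV. x $ i) + v * (\<Sum>i\<in>UNIV. y $ i)"
    by (simp add: sum.distrib sum_distrib_left)
  also have "\<dots> \<le> r"
    using x y uv by (intro convex_bound_le) auto
  finally show "u *\<^sub>R x + v *\<^sub>R y \<in> {x \<in> nonneg_orthant. (\<Sum>i\<in>UNIV. x $ i) \<le> r}"
    using x y uv by (auto simp: nonneg_orthant_def)
qed

text \<open>Rescale a truncated solution \<open>x\<close> with large \<open>s = sum x\<close> to \<open>u = x / s\<close> in the simplex.  It
  solves the inequality on the unit truncation with constant term \<open>q / s^(m-1)\<close>, which vanishes in
  the limit; testing against \<open>y = 0\<close> gives \<open>q \<bullet> u \<le> 0\<close> by copositivity.  A limit \<open>v\<close> of such \<open>u\<close>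
  satisfies \<open>0 \<le> F v \<bullet> (y - v)\<close> on the unit truncation: \<open>y = 0\<close> and copositivity give
  \<open>F v \<bullet> v = 0\<close>, and unit vectors \<open>y\<close> give \<open>F v \<ge> 0\<close>.  So \<open>v\<close> is a nonzero homogeneous solution with \<open>q \<bullet> v \<le> 0\<close>.\<close>

lemma bounded_truncated_solutions:
  fixes A :: "'n::finite tensor"
  assumes m: "m \<ge> 2" and cop: "copositive m A"
    and q: "q \<in> interior (dual_cone (SOL m nonneg_orthant 0 A))"
  shows "bounded (truncated_solutions m q A)"
proof (rule ccontr)
  assume unb: "\<not> bounded (truncated_solutions m q A)"
  let ?F = "tensor_apply m A"
  let ?\<Delta> = "{x \<in> nonneg_orthant :: (real^'n) set. (\<Sum>i\<in>UNIV. x $ i) = 1}"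
  have "\<exists>x\<in>truncated_solutions m q A. real k + 1 < (\<Sum>i\<in>UNIV. x $ i)" for k
  proof -
    obtain x where x: "x \<in> truncated_solutions m q A" "real k + 1 < norm x"
      using unb unfolding bounded_iff by (meson not_le)
    moreover have "norm x \<le> (\<Sum>i\<in>UNIV. x $ i)"
      using x by (intro norm_le_sum_nonneg_orthant) (simp add: truncated_solutions_def)
    ultimately show ?thesis by force
  qed
  then obtain x where x: "\<And>k. x k \<in> truncated_solutions m q A"
    and big: "\<And>k. real k + 1 < (\<Sum>i\<in>UNIV. x k $ i)"
    by metis
  define s where "s k = (\<Sum>i\<in>UNIV. x k $ i)" for k
  define u where "u k = (1 / s k) *\<^sub>R x k" for k
  have s: "real k + 1 < s k" "0 < s k" for k
    using big[of k] by (auto simp: s_def)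
  have xu: "x k = s k *\<^sub>R u k" for k
    using s(2)[of k] by (simp add: u_def)
  have x_nonneg: "x k \<in> nonneg_orthant" for k
    using x[of k] by (simp add: truncated_solutions_def)
  have u_nonneg: "u k \<in> nonneg_orthant" for k
    using x_nonneg[of k] s(2)[of k] by (simp add: u_def nonneg_orthant_def)
  have "(\<Sum>i\<in>UNIV. u k $ i) = 1" for k
    using s(2)[of k] by (simp add: u_def s_def sum_divide_distrib[symmetric])
  with u_nonneg have u_simplex: "u k \<in> ?\<Delta>" for k by simp
  define c where "c k = 1 / s k ^ (m - 1)" for k
  have vi: "0 \<le> (?F (u k) + c k *\<^sub>R q) \<bullet> (y - u k)"
    if y: "y \<in> nonneg_orthant" "(\<Sum>i\<in>UNIV. y $ i) \<le> 1" for y k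
  proof -
    have "s k *\<^sub>R y \<in> nonneg_orthant"
      using y(1) s(2)[of k] by (simp add: nonneg_orthant_def)
    moreover have "(\<Sum>i\<in>UNIV. (s k *\<^sub>R y) $ i) \<le> s k"
      using y(2) s(2)[of k] by (simp add: sum_distrib_left[symmetric])
    ultimately have "0 \<le> (?F (x k) + q) \<bullet> (s k *\<^sub>R y - x k)"
      using x[of k] by (simp add: truncated_solutions_def s_def)
    also have "?F (x k) + q = s k ^ (m - 1) *\<^sub>R (?F (u k) + c k *\<^sub>R q)"
      using s(2)[of k] by (simp add: xu tensor_apply_scaleR c_def scaleR_add_right)
    also have "s k *\<^sub>R y - x k = s k *\<^sub>R (y - u k)"
      by (simp add: xu scaleR_diff_right)
    finally have "0 \<le> (s k ^ (m - 1) * s k) * ((?F (u k) + c k *\<^sub>R q) \<bullet> (y - u k))"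
      by (simp add: mult.assoc mult.left_commute)
    moreover have "0 < s k ^ (m - 1) * s k" using s(2)[of k] by simp
    ultimately show ?thesis
      by (simp add: zero_le_mult_iff)
  qed
  have cop': "0 \<le> ?F v \<bullet> v" if "v \<in> nonneg_orthant" for v
    using cop that by (simp add: copositive_def tensor_form_def inner_commute)
  have zero: "(0 :: real^'n) \<in> nonneg_orthant" by (simp add: nonneg_orthant_def)
  have qu: "q \<bullet> u k \<le> 0" for k
  proof -
    have "0 \<le> (?F (u k) + c k *\<^sub>R q) \<bullet> (0 - u k)"
      by (rule vi) (use zero in auto)
    then have "c k * (q \<bullet> u k) \<le> 0"
      using cop'[OF u_nonneg, of k] by (simp add: inner_add_left inner_diff_right)
    moreover have "0 < c k" using s(2)[of k] by (simp add: c_def)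
    ultimately show ?thesis by (simp add: mult_le_0_iff)
  qed
  obtain v r where v: "v \<in> ?\<Delta>" and r: "strict_mono (r :: nat \<Rightarrow> nat)" and lim: "(u \<circ> r) \<longlonglongrightarrow> v"
    using compact_simplex[of 1] u_simplex unfolding compact_def by blast
  have ur: "(\<lambda>k. u (r k)) \<longlonglongrightarrow> v" using lim by (simp add: o_def)
  have "c \<longlonglongrightarrow> 0"
  proof (rule tendsto_sandwich)
    have "c k \<le> 1 / (real k + 1)" for k
    proof -
      have "1 \<le> s k" using s(1)[of k] by simp
      then have "s k ^ 1 \<le> s k ^ (m - 1)" using m by (intro power_increasing) auto
      then show ?thesis
        using s[of k] by (simp add: c_def frac_le)
    qed
    then show "\<forall>\<^sub>F k in sequentially. c k \<le> 1 / (real k + 1)" by simp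
    show "\<forall>\<^sub>F k in sequentially. 0 \<le> c k" using s(2) by (simp add: c_def less_imp_le)
    show "(\<lambda>k. 1 / (real k + 1)) \<longlonglongrightarrow> 0"
      using LIMSEQ_inverse_real_of_nat by (simp add: inverse_eq_divide add.commute)
  qed simp
  then have cr: "(\<lambda>k. c (r k)) \<longlonglongrightarrow> 0"
    using LIMSEQ_subseq_LIMSEQ[OF _ r, of c 0] by (simp add: o_def)
  have "isCont ?F v"
    using continuous_on_tensor_apply[of UNIV m A] by (simp add: continuous_on_eq_continuous_at)
  then have Fr: "(\<lambda>k. ?F (u (r k))) \<longlonglongrightarrow> ?F v"
    using ur by (rule isCont_tendsto_compose)
  have vi_v: "0 \<le> ?F v \<bullet> (y - v)" if y: "y \<in> nonneg_orthant" "(\<Sum>i\<in>UNIV. y $ i) \<le> 1" for y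
  proof (rule LIMSEQ_le_const)
    have "(\<lambda>k. (?F (u (r k)) + c (r k) *\<^sub>R q) \<bullet> (y - u (r k))) \<longlonglongrightarrow> (?F v + 0 *\<^sub>R q) \<bullet> (y - v)"
      by (intro tendsto_intros Fr cr ur)
    then show "(\<lambda>k. (?F (u (r k)) + c (r k) *\<^sub>R q) \<bullet> (y - u (r k))) \<longlonglongrightarrow> ?F v \<bullet> (y - v)"
      by simp
  qed (use vi[OF y] in blast)
  have "0 \<le> ?F v \<bullet> (0 - v)"
    by (rule vi_v) (use zero in auto)
  then have comp: "?F v \<bullet> v = 0"
    using cop'[of v] v by (simp add: inner_diff_right)
  have "0 \<le> ?F v $ i" for i
  proof -
    have "0 \<le> ?F v \<bullet> (axis i 1 - v)"
      by (rule vi_v) (auto simp: nonneg_orthant_def axis_def)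
    then show ?thesis using comp by (simp add: inner_diff_right inner_axis)
  qed
  then have "v \<in> SOL m nonneg_orthant 0 A"
    using v comp by (simp add: SOL_nonneg_orthant_iff inner_commute) (simp add: nonneg_orthant_def)
  moreover have "v \<noteq> 0" using v by auto
  ultimately have "0 < q \<bullet> v"
    using q interior_dual_cone_pos by blast
  moreover have "q \<bullet> v \<le> 0"
    by (rule LIMSEQ_le_const2[of "\<lambda>k. q \<bullet> u (r k)"]) (use qu ur in \<open>auto intro: tendsto_inner\<close>)
  ultimately show False by simp
qed

section \<open>Existence and compactness\<close>

text \<open>At a truncation level \<open>r\<close> beyond the bound, the solution \<open>x\<close> that Brouwer's theorem provides
  has \<open>sum x < r\<close>.  There is room to step from \<open>x\<close> along every coordinate axis, which makes
  \<open>w = F x + q\<close> nonnegative; the test vector \<open>0\<close> then gives \<open>x \<bullet> w = 0\<close>.\<close>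

lemma SOL_interior:
  fixes A :: "'n::finite tensor"
  assumes m: "m \<ge> 2" and cop: "copositive m A"
    and q: "q \<in> interior (dual_cone (SOL m nonneg_orthant 0 A))"
  shows "SOL m nonneg_orthant q A \<noteq> {}" and "compact (SOL m nonneg_orthant q A)"
proof -
  have bdd: "bounded (truncated_solutions m q A)"
    by (rule bounded_truncated_solutions[OF assms])
  have "bounded ((\<lambda>x. \<Sum>i\<in>UNIV. x $ i) ` truncated_solutions m q A)"
    by (intro bounded_linear_image[OF bdd] bounded_linear_sum bounded_linear_vec_nth)
  then obtain b where b: "b > 0" "\<And>x. x \<in> truncated_solutions m q A \<Longrightarrow> \<bar>\<Sum>i\<in>UNIV. x $ i\<bar> \<le> b"
    unfolding bounded_pos by auto
  define r where "r = b + 1"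
  let ?D = "{x \<in> nonneg_orthant :: (real^'n) set. (\<Sum>i\<in>UNIV. x $ i) \<le> r}"
  have zero: "0 \<in> ?D" using b by (simp add: nonneg_orthant_def r_def)
  have "continuous_on ?D (\<lambda>x. tensor_apply m A x + q)"
    by (intro continuous_intros continuous_on_tensor_apply)
  with zero obtain x where x: "x \<in> ?D"
    and vi: "\<And>y. y \<in> ?D \<Longrightarrow> 0 \<le> (tensor_apply m A x + q) \<bullet> (y - x)"
    using variational_inequality_solvable[OF compact_truncated_orthant convex_truncated_orthant,
        of r "\<lambda>x. tensor_apply m A x + q"]
    by blast
  define w where "w = tensor_apply m A x + q"
  have "x \<in> truncated_solutions m q A"
    using x vi by (auto simp: truncated_solutions_def)
  from b(2)[OF this] have slack: "(\<Sum>i\<in>UNIV. x $ i) + 1 \<le> r" by (simp add: r_def)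
  have w_nonneg: "0 \<le> w $ i" for i
  proof -
    have "(\<Sum>j\<in>UNIV. (x + axis i 1) $ j) = (\<Sum>j\<in>UNIV. x $ j) + 1"
      by (simp add: sum.distrib axis_def)
    then have "x + axis i 1 \<in> ?D"
      using x slack by (auto simp: nonneg_orthant_def axis_def)
    from vi[OF this] show ?thesis by (simp add: w_def inner_axis)
  qed
  have "0 \<le> x \<bullet> w"
    using x w_nonneg by (auto simp: inner_vec_def nonneg_orthant_def intro!: sum_nonneg)
  moreover have "x \<bullet> w \<le> 0"
    using vi[OF zero] by (simp add: w_def inner_diff_right inner_commute)
  ultimately have "x \<in> SOL m nonneg_orthant q A"
    using x w_nonneg unfolding SOL_nonneg_orthant_iff w_def[symmetric]
    by (simp add: nonneg_orthant_def)
  then show "SOL m nonneg_orthant q A \<noteq> {}" by blast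
  show "compact (SOL m nonneg_orthant q A)"
    using bounded_subset[OF bdd SOL_subset_truncated_solutions] closed_SOL
    by (simp add: compact_eq_bounded_closed)
qed

theorem theorem4p1:
  fixes m :: nat and A :: "'n::finite tensor"
  assumes "m \<ge> 2"
    and "copositive m A"
    and "\<And>\<alpha> :: 'n set. \<alpha> \<noteq> {} \<Longrightarrow> closed (Tpos m nonneg_orthant (complementary_tensor A \<alpha>))"
  shows "(\<forall>q \<in> dual_cone (SOL m nonneg_orthant 0 A). SOL m nonneg_orthant q A \<noteq> {}) \<and>
         (\<forall>q \<in> interior (dual_cone (SOL m nonneg_orthant 0 A)). compact (SOL m nonneg_orthant q A))"
proof -
  let ?S = "SOL m nonneg_orthant 0 A"
  have "dual_cone ?S \<subseteq> closure (interior (dual_cone ?S))"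
    by (intro dual_cone_subset_closure_interior) (auto simp: SOL_def)
  also have "\<dots> \<subseteq> {q. SOL m nonneg_orthant q A \<noteq> {}}"
    using SOL_interior(1)[OF assms(1,2)]
    by (intro closure_minimal closed_solvable assms) auto
  finally show ?thesis
    using SOL_interior(2)[OF assms(1,2)] by auto
qed

end
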